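(* Let $\mathbb{K}$ be a semiring. If $f\colon\mathbb{N}^d\to\mathbb{N}^{d'}$ is an $(\boldsymbol{\mathcal{S}},\boldsymbol{\mathcal{S}}')$-synchronized sequence and $g\colon\mathbb{N}^{d'}\to\mathbb{K}$ is an $(\boldsymbol{\mathcal{S}}',\mathbb{K})$-regular sequence, then $g\circ f\colon\mathbb{N}^d\to\mathbb{K}$ is $(\boldsymbol{\mathcal{S}},\mathbb{K})$-regular.
   Context: An abstract numeration system is a triple $\mathcal{S}=(L,A,<)$ where $L$ is an infinite regular language over a finite alphabet $A$ totally ordered by $<$. Words are ordered by the radix order ($u<_{\rm rad}v$ iff $|u|<|v|$, or $|u|=|v|$ and $u$ is lexicographically smaller); $\mathrm{rep}_{\mathcal{S}}\colon\mathbb{N}\to L$ maps $n$ to the $n$-th word of $L$ (indexing from $0$) and $\mathrm{val}_{\mathcal{S}}$ is its inverse. For $e\ge1$, abstract numeration systems $\mathcal{T}_j=(K_j,B_j,<_j)$ and a symbol $\#\notin\bigcup_jB_j$, the $e$-dimensional system $\boldsymbol{\mathcal{T}}=(\mathcal{T}_1,\dots,\mathcal{T}_e)$ has alphabet $\boldsymbol{B}=\big((B_1\cup\{\#\})\times\cdots\times(B_e\cup\{\#\})\big)\setminus\{(\#,\dots,\#)\}$, numeration language $\boldsymbol{K}$ consisting of the words over $\boldsymbol{B}$ obtained from $(w_1,\dots,w_e)\in K_1\times\cdots\times K_e$ by left-padding each $w_j$ with $\#$'s to the maximal length and reading them in parallel, and $\mathrm{rep}_{\boldsymbol{\mathcal{T}}}(n_1,\dots,n_e)$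 is the word so obtained from $(\mathrm{rep}_{\mathcal{T}_1}(n_1),\dots,\mathrm{rep}_{\mathcal{T}_e}(n_e))$, a bijection $\mathbb{N}^e\to\boldsymbol{K}$ with inverse $\mathrm{val}_{\boldsymbol{\mathcal{T}}}$. A set $X\subseteq\mathbb{N}^e$ is $\boldsymbol{\mathcal{T}}$-recognizable if $\mathrm{rep}_{\boldsymbol{\mathcal{T}}}(X)$ is regular. $\boldsymbol{\mathcal{S}}$ and $\boldsymbol{\mathcal{S}}'$ are such systems of dimensions $d$ and $d'$, and $(\boldsymbol{\mathcal{S}},\boldsymbol{\mathcal{S}}')$ is their concatenation. $f$ is $(\boldsymbol{\mathcal{S}},\boldsymbol{\mathcal{S}}')$-synchronized if its graph $\{(\boldsymbol{n},f(\boldsymbol{n})):\boldsymbol{n}\in\mathbb{N}^d\}$ is $(\boldsymbol{\mathcal{S}},\boldsymbol{\mathcal{S}}')$-recognizable. A series $S\colon A^*\to\mathbb{K}$ is $\mathbb{K}$-recognizable if there exist $r\ge1$, a monoid morphism $\mu\colon A^*\to\mathbb{K}^{r\times r}$, $\lambda\in\mathbb{K}^{1\times r}$, $\gamma\in\mathbb{K}^{r\times1}$ with $(S,w)=\lambda\mu(w)\gamma$ for all $w$. A sequence $h\colon\mathbb{N}^e\to\mathbb{K}$ is $(\boldsymbol{\mathcal{T}},\mathbb{K})$-regular if the series $\sum_{\boldsymbol{w}\in\boldsymbol{K}}h(\mathrm{val}_{\boldsymbol{\mathcal{T}}}(\boldsymbol{w}))\,\boldsymbol{w}$ over $\boldsymbol{B}$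 is $\mathbb{K}$-recognizable. *)

theory Defs
  imports "Jordan_Normal_Form.Matrix"
begin

text \<open>Regular languages over a finite alphabet \<open>A\<close>, by complete deterministic finite automata.
  A finite state set can always be renamed into the natural numbers.\<close>

definition regular_language :: "'a set \<Rightarrow> 'a list set \<Rightarrow> bool" where
  "regular_language A L \<longleftrightarrow>
     finite A \<and>
     (\<exists>(Q :: nat set) \<delta> q0 F. finite Q \<and> q0 \<in> Q \<and> F \<subseteq> Q \<and> (\<forall>q\<in>Q. \<forall>a\<in>A. \<delta> q a \<in> Q) \<and>
        L = {w \<in> lists A. foldl \<delta> q0 w \<in> F})"

text \<open>The order is the set of pairs \<open>(a, b)\<close> with \<open>a < b\<close>; the library's \<open>lenlex\<close> of it is then
  the (strict) radix order. Systems combined with one another share one ambient type of letters,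
  but each has its own alphabet and its own order.\<close>

record 'a numeration =
  lang :: "'a list set"
  alphabet :: "'a set"
  order :: "'a rel"

definition numeration_system :: "'a numeration \<Rightarrow> bool" where
  "numeration_system T \<longleftrightarrow>
     finite (alphabet T) \<and>
     order T \<subseteq> alphabet T \<times> alphabet T \<and> strict_linear_order_on (alphabet T) (order T) \<and>
     regular_language (alphabet T) (lang T) \<and> infinite (lang T)"

definition rep :: "'a numeration \<Rightarrow> nat \<Rightarrow> 'a list" where
  "rep T n = (THE w. w \<in> lang T \<and> card {u \<in> lang T. (u, w) \<in> lenlex (order T)} = n)"

text \<open>Multidimensional systems are nonempty lists of systems. The padding symbol \<open>#\<close> is \<open>None\<close>,
  the letters proper are \<open>Some a\<close>, and a letter of an \<open>e\<close>-dimensional system is a list of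
  length \<open>e\<close>. Vectors in \<open>\<nat>\<^sup>e\<close> are likewise lists of length \<open>e\<close>.\<close>

definition multi_system :: "'a numeration list \<Rightarrow> bool" where
  "multi_system Ts \<longleftrightarrow> Ts \<noteq> [] \<and> (\<forall>T \<in> set Ts. numeration_system T)"

definition vectors :: "nat \<Rightarrow> nat list set" where
  "vectors e = {ns. length ns = e}"

definition multi_alphabet :: "'a numeration list \<Rightarrow> 'a option list set" where
  "multi_alphabet Ts =
     listset (map (\<lambda>T. insert None (Some ` alphabet T)) Ts) - {replicate (length Ts) None}"

definition pad_left :: "nat \<Rightarrow> 'a list \<Rightarrow> 'a option list" where
  "pad_left m w = replicate (m - length w) None @ map Some w"

definition parallel :: "'a list list \<Rightarrow> 'a option list list" where
  "parallel ws =
     (let m = Max (length ` set ws) in map (\<lambda>i. map (\<lambda>w. pad_left m w ! i) ws) [0..<m])"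

definition multi_lang :: "'a numeration list \<Rightarrow> 'a option list list set" where
  "multi_lang Ts = parallel ` listset (map lang Ts)"

definition multi_rep :: "'a numeration list \<Rightarrow> nat list \<Rightarrow> 'a option list list" where
  "multi_rep Ts ns = parallel (map2 rep Ts ns)"

definition multi_val :: "'a numeration list \<Rightarrow> 'a option list list \<Rightarrow> nat list" where
  "multi_val Ts = inv_into (vectors (length Ts)) (multi_rep Ts)"

definition recognizable_set :: "'a numeration list \<Rightarrow> nat list set \<Rightarrow> bool" where
  "recognizable_set Ts X \<longleftrightarrow>
     X \<subseteq> vectors (length Ts) \<and> regular_language (multi_alphabet Ts) (multi_rep Ts ` X)"

text \<open>The concatenation of two multidimensional systems, and of two vectors, is list append.\<close>

definition synchronized ::
    "'a numeration list \<Rightarrow> 'a numeration list \<Rightarrow> (nat list \<Rightarrow> nat list) \<Rightarrow> bool" where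
  "synchronized Ss Ss' f \<longleftrightarrow>
     recognizable_set (Ss @ Ss') {ns @ f ns | ns. ns \<in> vectors (length Ss)}"

text \<open>The sort \<open>{semiring_0, monoid_mult}\<close> is that of arbitrary semirings with zero and unit,
  not necessarily commutative; the class \<open>semiring_1\<close> would in addition demand \<open>0 \<noteq> 1\<close>.\<close>

definition recognizable_series ::
    "'b set \<Rightarrow> ('b list \<Rightarrow> 'k :: {semiring_0, monoid_mult}) \<Rightarrow> bool" where
  "recognizable_series A S \<longleftrightarrow>
     (\<exists>r \<ge> 1. \<exists>\<mu> :: 'b list \<Rightarrow> 'k mat. \<exists>l \<in> carrier_mat 1 r. \<exists>c \<in> carrier_mat r 1.
        (\<forall>w \<in> lists A. \<mu> w \<in> carrier_mat r r) \<and>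
        \<mu> [] = 1\<^sub>m r \<and>
        (\<forall>u \<in> lists A. \<forall>v \<in> lists A. \<mu> (u @ v) = \<mu> u * \<mu> v) \<and>
        (\<forall>w \<in> lists A. S w = (l * \<mu> w * c) $$ (0, 0)))"

definition regular_sequence ::
    "'a numeration list \<Rightarrow> (nat list \<Rightarrow> 'k :: {semiring_0, monoid_mult}) \<Rightarrow> bool" where
  "regular_sequence Ts h \<longleftrightarrow>
     recognizable_series (multi_alphabet Ts)
       (\<lambda>w. if w \<in> multi_lang Ts then h (multi_val Ts w) else 0)"

end

theory Submission
  imports Defs
begin

text \<open>Put \<open>G = {rep (n, f n)}\<close>. A word \<open>w = rep n\<close> of the first system lifts to the words
  \<open>p @ z\<close> whose first \<open>d\<close> tracks read padding along \<open>p\<close> and \<open>w\<close> along \<open>z\<close>. Exactly one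
  lift lies in \<open>G\<close>, and deleting padding from its last \<open>d'\<close> tracks gives \<open>rep (f n)\<close>. Hence
  the series of \<open>g \<circ> f\<close> is the sum over all lifts of the indicator of \<open>G\<close> times the series
  of \<open>g\<close>, read on the last tracks with padding deleted. For a fixed \<open>p\<close>, running the automaton
  of \<open>G\<close> alongside a linear representation of \<open>g\<close> and summing over the letters above each
  letter of \<open>w\<close> makes the inner sum recognizable. Only finitely many prefixes \<open>p\<close> occur, since
  \<open>f\<close> is a function; so no infinite sum is needed in the semiring.\<close>

section \<open>Recognizable series without matrices\<close>

text \<open>Collecting the coefficients of equal targets turns a sum over transitions into a matrix
  row times a vector. Coefficients stay on the left, since multiplication need not commute.\<close>

lemma sum_regroup:
  fixes c :: "'x \<Rightarrow> 'k :: semiring_0"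
  assumes "finite K" "finite Y" "\<phi> ` K \<subseteq> Y"
  shows "(\<Sum>k\<in>K. c k * X (\<phi> k)) = (\<Sum>y\<in>Y. (\<Sum>k\<in>{k \<in> K. \<phi> k = y}. c k) * X y)"
proof -
  have "(\<Sum>y\<in>Y. (\<Sum>k\<in>{k \<in> K. \<phi> k = y}. c k) * X y)
      = (\<Sum>y\<in>Y. \<Sum>k\<in>{k \<in> K. \<phi> k = y}. c k * X (\<phi> k))"
    by (intro sum.cong refl) (auto simp: sum_distrib_right)
  also have "\<dots> = (\<Sum>k\<in>K. c k * X (\<phi> k))"
    using assms by (rule sum.group)
  finally show ?thesis by simp
qed

text \<open>The library proves the unit laws only in class \<open>semiring_1\<close>, that is, assuming \<open>0 \<noteq> 1\<close>.\<close>

lemma one_mat_mult: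
  fixes A :: "'k :: {semiring_0, monoid_mult} mat"
  assumes "A \<in> carrier_mat n m"
  shows "1\<^sub>m n * A = A"
proof (rule eq_matI)
  fix i j assume ij: "i < dim_row A" "j < dim_col A"
  have "(1\<^sub>m n * A) $$ (i, j) = (\<Sum>k\<in>{0..<n}. (if i = k then 1 else 0) * A $$ (k, j))"
    using ij assms by (auto simp: scalar_prod_def intro!: sum.cong)
  also have "\<dots> = (\<Sum>k\<in>{0..<n}. if i = k then A $$ (k, j) else 0)"
    by (intro sum.cong) auto
  also have "\<dots> = A $$ (i, j)"
    using ij assms by simp
  finally show "(1\<^sub>m n * A) $$ (i, j) = A $$ (i, j)" .
qed (use assms in auto)

text \<open>\<open>T i w\<close> is entry \<open>i\<close> of the matrix of \<open>w\<close> applied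
  to the final vector, so splitting off a prefix \<open>u\<close> means multiplying by the matrix of
  \<open>u\<close>. Prefixes are words rather than letters because they will be images
  \<open>h [x]\<close>, possibly empty, and \<open>h p\<close>.\<close>

lemma recognizable_series_shift_family:
  fixes S :: "'b list \<Rightarrow> 'k :: {semiring_0, monoid_mult}"
  assumes "recognizable_series A S"
  obtains r l T M where "r \<ge> (1 :: nat)"
    "\<And>w. w \<in> lists A \<Longrightarrow> S w = (\<Sum>i<r. l i * T i w)"
    "\<And>i u v. i < r \<Longrightarrow> u \<in> lists A \<Longrightarrow> v \<in> lists A \<Longrightarrow>
       T i (u @ v) = (\<Sum>j<r. M u i j * T j v)"
proof -
  obtain r :: nat and \<mu> :: "'b list \<Rightarrow> 'k mat" and l c where r: "r \<ge> 1"
    and l: "l \<in> carrier_mat 1 r" and c: "c \<in> carrier_mat r 1"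
    and \<mu>: "\<And>w. w \<in> lists A \<Longrightarrow> \<mu> w \<in> carrier_mat r r"
    and app: "\<And>u v. u \<in> lists A \<Longrightarrow> v \<in> lists A \<Longrightarrow> \<mu> (u @ v) = \<mu> u * \<mu> v"
    and S: "\<And>w. w \<in> lists A \<Longrightarrow> S w = (l * \<mu> w * c) $$ (0, 0)"
    using assms unfolding recognizable_series_def by blast
  define T where "T i w = (\<mu> w * c) $$ (i, 0)" for i w
  have S': "S w = (\<Sum>i<r. l $$ (0, i) * T i w)" if w: "w \<in> lists A" for w
  proof -
    have "S w = (l * (\<mu> w * c)) $$ (0, 0)"
      using S[OF w] assoc_mult_mat[OF l \<mu>[OF w] c] by simp
    also have "\<dots> = (\<Sum>i\<in>{0..<r}. l $$ (0, i) * T i w)"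
      using l c \<mu>[OF w] unfolding T_def by (auto simp: scalar_prod_def intro!: sum.cong)
    finally show ?thesis by (simp add: atLeast0LessThan)
  qed
  have T: "T i (u @ v) = (\<Sum>j<r. \<mu> u $$ (i, j) * T j v)"
    if i: "i < r" and u: "u \<in> lists A" and v: "v \<in> lists A" for i u v
  proof -
    have "T i (u @ v) = (\<mu> u * (\<mu> v * c)) $$ (i, 0)"
      using app[OF u v] assoc_mult_mat[OF \<mu>[OF u] \<mu>[OF v] c] by (simp add: T_def)
    also have "\<dots> = (\<Sum>j\<in>{0..<r}. \<mu> u $$ (i, j) * T j v)"
      using i c \<mu>[OF u] \<mu>[OF v] unfolding T_def by (auto simp: scalar_prod_def intro!: sum.cong)
    finally show ?thesis by (simp add: atLeast0LessThan)
  qed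
  show ?thesis using that[OF r S' T] .
qed

text \<open>Converse of the shift family: the coefficients \<open>m a\<close> form the matrix of the
  letter \<open>a\<close>, and by induction the matrix of \<open>w\<close> sends the column
  \<open>C []\<close> of values at the empty word to the column \<open>C w\<close>.\<close>

lemma recognizable_seriesI_nat:
  fixes S :: "'b list \<Rightarrow> 'k :: {semiring_0, monoid_mult}"
  assumes r: "r \<ge> (1 :: nat)"
    and S: "\<And>w. w \<in> lists A \<Longrightarrow> S w = (\<Sum>i<r. l i * T i w)"
    and T: "\<And>i a w. i < r \<Longrightarrow> a \<in> A \<Longrightarrow> w \<in> lists A \<Longrightarrow>
       T i (a # w) = (\<Sum>j<r. m a i j * T j w)"
  shows "recognizable_series A S"
proof -
  define N where "N a = mat r r (\<lambda>(i, j). m a i j)" for a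
  define \<mu> where "\<mu> w = foldr (\<lambda>a X. N a * X) w (1\<^sub>m r)" for w
  define L where "L = mat 1 r (\<lambda>(i, j). l j)"
  define C where "C w = mat r 1 (\<lambda>(i, j). T i w)" for w
  have N: "N a \<in> carrier_mat r r" for a by (simp add: N_def)
  have C: "C w \<in> carrier_mat r 1" for w by (simp add: C_def)
  have L: "L \<in> carrier_mat 1 r" by (simp add: L_def)
  have \<mu>: "\<mu> w \<in> carrier_mat r r" for w
    by (induction w) (auto simp: \<mu>_def intro!: mult_carrier_mat[OF N])
  have \<mu>_Cons: "\<mu> (a # w) = N a * \<mu> w" for a w by (simp add: \<mu>_def)
  have \<mu>_Nil: "\<mu> [] = 1\<^sub>m r" by (simp add: \<mu>_def)
  have app: "\<mu> (u @ v) = \<mu> u * \<mu> v" for u v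
  proof (induction u)
    case Nil
    show ?case using one_mat_mult[OF \<mu>[of v]] by (simp add: \<mu>_Nil)
  next
    case (Cons a u)
    then show ?case
      using assoc_mult_mat[OF N \<mu>[of u] \<mu>[of v]] by (simp add: \<mu>_Cons)
  qed
  have \<mu>C: "\<mu> w * C [] = C w" if "w \<in> lists A" for w
    using that
  proof (induction w)
    case Nil
    show ?case using one_mat_mult[OF C] by (simp add: \<mu>_Nil)
  next
    case (Cons a w)
    have "\<mu> (a # w) * C [] = N a * C w"
      using assoc_mult_mat[OF N \<mu>[of w] C] Cons by (simp add: \<mu>_Cons)
    also have "\<dots> = C (a # w)"
    proof (rule eq_matI)
      fix i j assume "i < dim_row (C (a # w))" "j < dim_col (C (a # w))"
      then have ij: "i < r" "j = 0" by (auto simp: C_def)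
      have "(N a * C w) $$ (i, j) = (\<Sum>k\<in>{0..<r}. m a i k * T k w)"
        using ij by (auto simp: N_def C_def scalar_prod_def intro!: sum.cong)
      then show "(N a * C w) $$ (i, j) = C (a # w) $$ (i, j)"
        using ij T[of i a w] Cons.hyps by (simp add: C_def atLeast0LessThan)
    qed (auto simp: N_def C_def)
    finally show ?case .
  qed
  have "S w = (L * \<mu> w * C []) $$ (0, 0)" if w: "w \<in> lists A" for w
  proof -
    have "L * \<mu> w * C [] = L * C w"
      using assoc_mult_mat[OF L \<mu>[of w] C] \<mu>C[OF w] by simp
    moreover have "(L * C w) $$ (0, 0) = (\<Sum>k\<in>{0..<r}. l k * T k w)"
      by (auto simp: L_def C_def scalar_prod_def intro!: sum.cong)
    ultimately show ?thesis using S[OF w] by (simp add: atLeast0LessThan)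
  qed
  then show ?thesis
    unfolding recognizable_series_def using r L C \<mu> \<mu>_Nil app by blast
qed

text \<open>Arbitrary finite index sets are allowed because \<open>I\<close> will consist of pairs
  of an automaton state and a coordinate.\<close>

lemma recognizable_seriesI:
  fixes S :: "'b list \<Rightarrow> 'k :: {semiring_0, monoid_mult}"
  assumes I: "finite I" "I \<noteq> {}"
    and S: "\<And>w. w \<in> lists A \<Longrightarrow> S w = (\<Sum>i\<in>I. l i * T i w)"
    and T: "\<And>i a w. i \<in> I \<Longrightarrow> a \<in> A \<Longrightarrow> w \<in> lists A \<Longrightarrow>
       T i (a # w) = (\<Sum>j\<in>I. m a i j * T j w)"
  shows "recognizable_series A S"
proof -
  obtain e where e: "bij_betw e {..<card I} I"
    using ex_bij_betw_nat_finite[OF I(1)] by (auto simp: atLeast0LessThan)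
  have re: "(\<Sum>i\<in>I. F i) = (\<Sum>i<card I. F (e i))" for F :: "_ \<Rightarrow> 'k"
    using sum.reindex_bij_betw[OF e, of F] by simp
  show ?thesis
  proof (rule recognizable_seriesI_nat[where r = "card I" and l = "\<lambda>i. l (e i)"
        and T = "\<lambda>i. T (e i)" and m = "\<lambda>a i j. m a (e i) (e j)"])
    show "card I \<ge> 1" using I by (simp add: Suc_le_eq card_gt_0_iff)
  qed (use S T re bij_betwE[OF e] in auto)
qed

section \<open>Summation along a rational relation\<close>

definition lifts :: "('x \<Rightarrow> 'b) \<Rightarrow> 'x set \<Rightarrow> 'b list \<Rightarrow> 'x list set" where
  "lifts \<pi> B w = {z \<in> lists B. map \<pi> z = w}"

lemma finite_lifts:
  assumes "finite B"
  shows "finite (lifts \<pi> B w)"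
proof (rule finite_subset)
  show "lifts \<pi> B w \<subseteq> {z. set z \<subseteq> B \<and> length z = length w}"
    by (auto simp: lifts_def)
qed (rule finite_lists_length_eq[OF assms])

lemma sum_lifts_Cons:
  "(\<Sum>z\<in>lifts \<pi> B (b # w). F z) = (\<Sum>x\<in>{x \<in> B. \<pi> x = b}. \<Sum>z\<in>lifts \<pi> B w. F (x # z))"
proof -
  have "bij_betw (\<lambda>(x, z). x # z) ({x \<in> B. \<pi> x = b} \<times> lifts \<pi> B w) (lifts \<pi> B (b # w))"
    by (rule bij_betwI[where g = "\<lambda>z. (hd z, tl z)"]) (auto simp: lifts_def)
  from sum.reindex_bij_betw[OF this, of F] show ?thesis
    by (simp add: sum.cartesian_product case_prod_beta)
qed

lemma foldl_in_states:
  assumes "\<And>q a. q \<in> Q \<Longrightarrow> a \<in> B \<Longrightarrow> \<delta> q a \<in> Q" "q \<in> Q" "w \<in> lists B"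
  shows "foldl \<delta> q w \<in> Q"
  using assms(2,3) by (induction w arbitrary: q) (auto simp: assms(1))

text \<open>Product of the automaton of \<open>G\<close> with the shift family of \<open>R\<close>,
  with coordinates \<open>U (q, i)\<close>. A letter \<open>a\<close> acts by summing over the
  letters \<open>x\<close> above it, each moving \<open>q\<close> to \<open>\<delta> q x\<close> and
  multiplying by the matrix of \<open>h [x]\<close>. The prefixes in \<open>P\<close> affect only
  the initial row.\<close>

lemma recognizable_series_sum_lifts:
  fixes R :: "'c list \<Rightarrow> 'k :: {semiring_0, monoid_mult}" and \<pi> :: "'x \<Rightarrow> 'b"
  assumes G: "regular_language B G"
    and R: "recognizable_series C R"
    and h: "\<And>u v. h (u @ v) = h u @ h v" "\<And>z. z \<in> lists B \<Longrightarrow> h z \<in> lists C"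
    and P: "finite P" "P \<subseteq> lists B"
  shows "recognizable_series A
    (\<lambda>w. \<Sum>p\<in>P. \<Sum>z\<in>lifts \<pi> B w. if p @ z \<in> G then R (h (p @ z)) else 0)"
proof -
  obtain Q :: "nat set" and \<delta> q0 F where B: "finite B" and Q: "finite Q" "q0 \<in> Q"
    and \<delta>: "\<And>q a. q \<in> Q \<Longrightarrow> a \<in> B \<Longrightarrow> \<delta> q a \<in> Q"
    and G_eq: "G = {w \<in> lists B. foldl \<delta> q0 w \<in> F}"
    using G unfolding regular_language_def by blast
  obtain r l T M where r: "r \<ge> (1 :: nat)"
    and R_eq: "\<And>w. w \<in> lists C \<Longrightarrow> R w = (\<Sum>i<r. l i * T i w)"
    and T: "\<And>i u v. i < r \<Longrightarrow> u \<in> lists C \<Longrightarrow> v \<in> lists C \<Longrightarrow>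
       T i (u @ v) = (\<Sum>j<r. M u i j * T j v)"
    by (rule recognizable_series_shift_family[OF R]) (rule that)
  define Z where "Z = lifts \<pi> B"
  have Z: "z \<in> lists B" if "z \<in> Z w" for z w using that by (auto simp: Z_def lifts_def)
  define U where "U = (\<lambda>(q, i) w. \<Sum>z\<in>Z w. if foldl \<delta> q z \<in> F then T i (h z) else 0)"
  define J where "J = Q \<times> {..<r}"
  have J: "finite J" "J \<noteq> {}" using Q r by (auto simp: J_def lessThan_empty_iff)
  \<comment> \<open>Here \<open>q\<close> is the state reached after \<open>p\<close>. The case
    \<open>p = [x]\<close> gives the recurrence, the case of \<open>p\<close> in \<open>P\<close>
    the initial row.\<close>
  have shift: "(\<Sum>z\<in>Z w. if foldl \<delta> q z \<in> F then T i (h (p @ z)) else 0)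
      = (\<Sum>j<r. M (h p) i j * U (q, j) w)"
    if "i < r" "p \<in> lists B" for w i p q
  proof -
    have "(\<Sum>z\<in>Z w. if foldl \<delta> q z \<in> F then T i (h (p @ z)) else 0)
        = (\<Sum>z\<in>Z w. \<Sum>j<r. M (h p) i j * (if foldl \<delta> q z \<in> F then T j (h z) else 0))"
      using that by (intro sum.cong refl) (auto simp: h T Z)
    also have "\<dots> = (\<Sum>j<r. M (h p) i j * U (q, j) w)"
      by (subst sum.swap) (simp add: U_def sum_distrib_left)
    finally show ?thesis .
  qed
  show ?thesis
  proof (rule recognizable_seriesI[OF J])
    fix a w and k assume k: "k \<in> J"
    obtain q i where qi: "k = (q, i)" "q \<in> Q" "i < r" using k by (auto simp: J_def)
    let ?K = "{x \<in> B. \<pi> x = a} \<times> {..<r}"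
    have "U k (a # w) = (\<Sum>x\<in>{x \<in> B. \<pi> x = a}.
        \<Sum>z\<in>Z w. if foldl \<delta> (\<delta> q x) z \<in> F then T i (h ([x] @ z)) else 0)"
      by (simp add: qi U_def Z_def sum_lifts_Cons cong: if_cong)
    also have "\<dots> = (\<Sum>x\<in>{x \<in> B. \<pi> x = a}. \<Sum>j<r. M (h [x]) i j * U (\<delta> q x, j) w)"
      using qi by (intro sum.cong refl shift) auto
    also have "\<dots> = (\<Sum>y\<in>?K. M (h [fst y]) i (snd y) * U (\<delta> q (fst y), snd y) w)"
      by (simp add: sum.cartesian_product case_prod_beta)
    \<comment> \<open>Different letters above \<open>a\<close> may lead to the same state; their
      matrix entries add up to one coefficient.\<close>
    also have "\<dots> = (\<Sum>j\<in>J. (\<Sum>y\<in>{y \<in> ?K. (\<delta> q (fst y), snd y) = j}.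
        M (h [fst y]) i (snd y)) * U j w)"
      using B J qi \<delta> by (intro sum_regroup[where X = "\<lambda>y. U y w"]) (auto simp: J_def)
    finally show "U k (a # w) = (\<Sum>j\<in>J. (\<lambda>a k j. \<Sum>y\<in>{y \<in> {x \<in> B. \<pi> x = a} \<times> {..<r}.
          (\<delta> (fst k) (fst y), snd y) = j}. M (h [fst y]) (snd k) (snd y)) a k j * U j w)"
      by (simp add: qi)
  next
    fix w
    \<comment> \<open>\<open>?c (p, j)\<close> is entry \<open>j\<close> of the row \<open>l\<close>
      times the matrix of \<open>h p\<close>; it is placed at the state reached by reading
      \<open>p\<close>.\<close>
    let ?K = "P \<times> {..<r}" and ?c = "\<lambda>(p, j). \<Sum>i<r. l i * M (h p) i j"
    have "(\<Sum>p\<in>P. \<Sum>z\<in>Z w. if p @ z \<in> G then R (h (p @ z)) else 0)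
        = (\<Sum>p\<in>P. \<Sum>j<r. ?c (p, j) * U (foldl \<delta> q0 p, j) w)"
    proof (rule sum.cong[OF refl])
      fix p assume "p \<in> P"
      then have p: "p \<in> lists B" using P by auto
      have "(\<Sum>z\<in>Z w. if p @ z \<in> G then R (h (p @ z)) else 0)
          = (\<Sum>z\<in>Z w. \<Sum>i<r. l i *
              (if foldl \<delta> (foldl \<delta> q0 p) z \<in> F then T i (h (p @ z)) else 0))"
      proof (rule sum.cong[OF refl])
        fix z assume "z \<in> Z w"
        then have "p @ z \<in> lists B" using p Z by auto
        then show "(if p @ z \<in> G then R (h (p @ z)) else 0) = (\<Sum>i<r. l i *
              (if foldl \<delta> (foldl \<delta> q0 p) z \<in> F then T i (h (p @ z)) else 0))"
          using R_eq[OF h(2)] by (simp add: G_eq)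
      qed
      also have "\<dots> = (\<Sum>i<r. l i *
          (\<Sum>z\<in>Z w. if foldl \<delta> (foldl \<delta> q0 p) z \<in> F then T i (h (p @ z)) else 0))"
        by (subst sum.swap) (simp add: sum_distrib_left)
      also have "\<dots> = (\<Sum>i<r. l i * (\<Sum>j<r. M (h p) i j * U (foldl \<delta> q0 p, j) w))"
        using shift p by (intro sum.cong) auto
      also have "\<dots> = (\<Sum>j<r. \<Sum>i<r. l i * M (h p) i j * U (foldl \<delta> q0 p, j) w)"
        by (subst sum.swap) (simp add: sum_distrib_left mult.assoc)
      finally show "(\<Sum>z\<in>Z w. if p @ z \<in> G then R (h (p @ z)) else 0)
          = (\<Sum>j<r. ?c (p, j) * U (foldl \<delta> q0 p, j) w)"
        by (simp add: sum_distrib_right)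
    qed
    also have "\<dots> = (\<Sum>y\<in>?K. ?c y * U (foldl \<delta> q0 (fst y), snd y) w)"
      by (simp add: sum.cartesian_product case_prod_beta)
    also have "\<dots> = (\<Sum>j\<in>J. (\<Sum>y\<in>{y \<in> ?K. (foldl \<delta> q0 (fst y), snd y) = j}. ?c y) * U j w)"
    proof (rule sum_regroup[where X = "\<lambda>y. U y w"])
      have "foldl \<delta> q0 p \<in> Q" if "p \<in> P" for p
        using foldl_in_states[of Q B \<delta>] \<delta> Q that P(2) by blast
      then show "(\<lambda>y. (foldl \<delta> q0 (fst y), snd y)) ` ?K \<subseteq> J" by (auto simp: J_def)
    qed (use P J in auto)
    finally show "(\<Sum>p\<in>P. \<Sum>z\<in>lifts \<pi> B w. if p @ z \<in> G then R (h (p @ z)) else 0) =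
        (\<Sum>j\<in>J. (\<Sum>y\<in>{y \<in> ?K. (foldl \<delta> q0 (fst y), snd y) = j}. ?c y) * U j w)"
      by (simp add: Z_def)
  qed
qed

section \<open>The representation map\<close>

text \<open>The count increases strictly along \<open>R\<close>, hence is injective. The counts of
  the predecessors of \<open>w\<close> are distinct and below that of \<open>w\<close>, so they
  exhaust the smaller numbers. The range is thus closed downwards, and it is unbounded as
  \<open>L\<close> is infinite.\<close>

lemma bij_betw_card_below:
  assumes tr: "\<And>u v w. u \<in> L \<Longrightarrow> v \<in> L \<Longrightarrow> w \<in> L \<Longrightarrow> (u, v) \<in> R \<Longrightarrow> (v, w) \<in> R \<Longrightarrow> (u, w) \<in> R"
    and ir: "\<And>u. u \<in> L \<Longrightarrow> (u, u) \<notin> R"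
    and tot: "\<And>u v. u \<in> L \<Longrightarrow> v \<in> L \<Longrightarrow> u \<noteq> v \<Longrightarrow> (u, v) \<in> R \<or> (v, u) \<in> R"
    and fin: "\<And>w. w \<in> L \<Longrightarrow> finite {u \<in> L. (u, w) \<in> R}"
    and inf: "infinite L"
  shows "bij_betw (\<lambda>w. card {u \<in> L. (u, w) \<in> R}) L (UNIV :: nat set)"
proof -
  define c where "c w = card {u \<in> L. (u, w) \<in> R}" for w
  have mono: "c u < c w" if "u \<in> L" "w \<in> L" "(u, w) \<in> R" for u w
    unfolding c_def using that tr ir by (intro psubset_card_mono fin) blast+
  have inj: "inj_on c L"
    by (rule inj_onI) (metis mono tot less_irrefl)
  have down: "n \<in> c ` L" if w: "w \<in> L" and n: "n < c w" for w n
  proof -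
    let ?D = "{u \<in> L. (u, w) \<in> R}"
    have "card (c ` ?D) = c w"
      unfolding c_def[of w] by (rule card_image) (rule inj_on_subset[OF inj], auto)
    moreover have "c ` ?D \<subseteq> {..<c w}" using mono w by auto
    ultimately have "c ` ?D = {..<c w}" by (intro card_subset_eq) auto
    then show ?thesis using n by blast
  qed
  have "n \<in> c ` L" for n
  proof -
    have "infinite (c ` L)" using inf inj finite_imageD by blast
    then obtain m where "m \<in> c ` L" "n < m"
      by (meson finite_nat_set_iff_bounded_le not_le)
    then show ?thesis using down by blast
  qed
  then have "bij_betw c L UNIV" using inj by (auto simp: bij_betw_def)
  then show ?thesis by (simp add: c_def[abs_def])
qed

text \<open>Totality holds on the alphabet only, so both words are taken over it. Equal lengths are
  settled by the first letters or, if these agree, by induction on the tails.\<close>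

lemma lenlex_total:
  assumes "total_on A r" "u \<in> lists A" "v \<in> lists A" "u \<noteq> v"
  shows "(u, v) \<in> lenlex r \<or> (v, u) \<in> lenlex r"
  using assms(2-4)
proof (induction u arbitrary: v)
  case (Cons a u)
  show ?case
  proof (cases v)
    case (Cons b v')
    then show ?thesis
      using Cons.prems Cons.hyps Cons.IH[of v'] assms(1)
      unfolding total_on_def by (auto simp: Cons_lenlex_iff)
  qed simp
qed simp

text \<open>\<open>rep\<close> inverts the count of radix predecessors. A word has finitely many of
  them, since they are no longer than it and the alphabet is finite.\<close>

lemma bij_betw_rep:
  assumes "numeration_system T"
  shows "bij_betw (rep T) UNIV (lang T)"
proof -
  let ?A = "alphabet T" and ?L = "lang T" and ?R = "lenlex (order T)"
  have A: "finite ?A" and ord: "order T \<subseteq> ?A \<times> ?A" "strict_linear_order_on ?A (order T)"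
    and L: "?L \<subseteq> lists ?A" and inf: "infinite ?L"
    using assms unfolding numeration_system_def regular_language_def by auto
  have trans: "trans (order T)" and irr: "irrefl (order T)" and tot: "total_on ?A (order T)"
    using ord(2) by (auto simp: strict_linear_order_on_def)
  let ?c = "\<lambda>w. card {u \<in> ?L. (u, w) \<in> ?R}"
  have bij: "bij_betw ?c ?L UNIV"
  proof (rule bij_betw_card_below[OF _ _ _ _ inf])
    fix u v w :: "'a list" assume "(u, v) \<in> ?R" "(v, w) \<in> ?R"
    then show "(u, w) \<in> ?R" using trans lenlex_transI transE by metis
  next
    fix u :: "'a list"
    show "(u, u) \<notin> ?R" using irr lenlex_irreflexive by (metis irreflD)
  next
    fix u v assume uv: "u \<in> ?L" "v \<in> ?L" "u \<noteq> v"
    show "(u, v) \<in> ?R \<or> (v, u) \<in> ?R"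
      using uv L by (intro lenlex_total[OF tot]) auto
  next
    fix w
    have "{u \<in> ?L. (u, w) \<in> ?R} \<subseteq> {u. set u \<subseteq> ?A \<and> length u \<le> length w}"
      using L by (auto dest: lenlex_length)
    then show "finite {u \<in> ?L. (u, w) \<in> ?R}"
      using finite_subset finite_lists_length_le[OF A] by blast
  qed
  have "rep T n = the_inv_into ?L ?c n" for n
    unfolding rep_def the_inv_into_def ..
  then have "rep T = the_inv_into ?L ?c" by blast
  then show ?thesis using bij_betw_the_inv_into[OF bij] by simp
qed

section \<open>Words of tuples\<close>

text \<open>Restricting a joint word to some of its tracks can leave letters that are padding
  throughout, which the smaller system does not have.\<close>

definition unpad :: "nat \<Rightarrow> 'a option list list \<Rightarrow> 'a option list list" where
  "unpad e = filter (\<lambda>x. x \<noteq> replicate e None)"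

lemma unpad_append: "unpad e (u @ v) = unpad e u @ unpad e v"
  by (simp add: unpad_def)

lemma unpad_padding: "(\<And>x. x \<in> set u \<Longrightarrow> x = replicate e None) \<Longrightarrow> unpad e u = []"
  by (auto simp: unpad_def filter_empty_conv)

lemma unpad_replicate: "unpad e (replicate k (replicate e None)) = []"
  by (rule unpad_padding) simp

lemma unpad_id: "replicate e None \<notin> set u \<Longrightarrow> unpad e u = u"
  by (auto simp: unpad_def intro!: filter_True)

lemma length_pad_left: "length w \<le> m \<Longrightarrow> length (pad_left m w) = m"
  by (simp add: pad_left_def)

lemma pad_left_pad_left:
  assumes "length w \<le> k" "k \<le> m"
  shows "pad_left m w = replicate (m - k) None @ pad_left k w"
proof -
  have "m - length w = (m - k) + (k - length w)" using assms by simp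
  then show ?thesis unfolding pad_left_def by (simp only: replicate_add append_assoc)
qed

lemma length_le_Max:
  assumes "w \<in> set ws"
  shows "length w \<le> Max (length ` set ws)"
  using assms by (intro Max_ge) auto

text \<open>The length is a parameter because a group of tracks inside a joint word is padded to the
  maximum over all tracks.\<close>

definition parallel_to :: "nat \<Rightarrow> 'a list list \<Rightarrow> 'a option list list" where
  "parallel_to m ws = map (\<lambda>i. map (\<lambda>w. pad_left m w ! i) ws) [0..<m]"

lemma parallel_eq: "parallel ws = parallel_to (Max (length ` set ws)) ws"
  by (simp add: parallel_def parallel_to_def Let_def)

lemma parallel_to_pad:
  assumes "\<And>w. w \<in> set ws \<Longrightarrow> length w \<le> k" "k \<le> m"
  shows "parallel_to m ws = replicate (m - k) (replicate (length ws) None) @ parallel_to k ws"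
proof (rule nth_equalityI)
  fix i assume i: "i < length (parallel_to m ws)"
  have "pad_left m w ! i = (if i < m - k then None else pad_left k w ! (i - (m - k)))"
    if "w \<in> set ws" for w
    using pad_left_pad_left[OF assms(1)[OF that] assms(2)] by (simp add: nth_append)
  then have "map (\<lambda>w. pad_left m w ! i) ws =
      (if i < m - k then replicate (length ws) None else map (\<lambda>w. pad_left k w ! (i - (m - k))) ws)"
    by (simp flip: map_replicate_const)
  then show "parallel_to m ws ! i =
      (replicate (m - k) (replicate (length ws) None) @ parallel_to k ws) ! i"
    using i assms(2) by (simp add: parallel_to_def nth_append)
qed (use assms in \<open>auto simp: parallel_to_def\<close>)

text \<open>A word of maximal length fills its track with proper letters.\<close>

lemma padding_notin_parallel:
  assumes "ws \<noteq> []"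
  shows "replicate (length ws) None \<notin> set (parallel ws)"
proof
  let ?m = "Max (length ` set ws)"
  assume "replicate (length ws) None \<in> set (parallel ws)"
  then obtain i where i: "i < ?m"
    and eq: "map (\<lambda>w. pad_left ?m w ! i) ws = replicate (length ws) None"
    by (auto simp: parallel_eq parallel_to_def)
  have "?m \<in> length ` set ws" using assms by (intro Max_in) auto
  then obtain w where w: "w \<in> set ws" "length w = ?m" by auto
  have "pad_left ?m w ! i \<in> set (map (\<lambda>w. pad_left ?m w ! i) ws)" using w by auto
  then have "pad_left ?m w ! i = None" unfolding eq by simp
  then show False using w i by (simp add: pad_left_def)
qed

lemma map_nth_parallel:
  assumes "j < length ws"
  shows "map (\<lambda>x. x ! j) (parallel ws) = pad_left (Max (length ` set ws)) (ws ! j)"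
  using assms length_pad_left[OF length_le_Max[OF nth_mem[OF assms]]]
  by (auto simp: parallel_eq parallel_to_def intro!: nth_equalityI)

text \<open>Each word is read off its track by dropping the padding.\<close>

lemma parallel_inj:
  assumes "length ws = length vs" "parallel ws = parallel vs"
  shows "ws = vs"
proof (rule nth_equalityI[OF assms(1)])
  fix j assume j: "j < length ws"
  have col: "map the (filter (\<lambda>x. x \<noteq> None) (map (\<lambda>x. x ! j) (parallel us))) = us ! j"
    if "j < length us" for us :: "'a list list"
    unfolding map_nth_parallel[OF that]
    by (simp add: pad_left_def filter_empty_conv comp_def)
  show "ws ! j = vs ! j" using col[of ws] col[of vs] j assms by simp
qed

text \<open>\<open>k\<close> is the excess of the joint maximal length over that of
  \<open>ws\<close>.\<close>

lemma parallel_append_take: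
  assumes "ws \<noteq> []"
  shows "\<exists>k. map (take (length ws)) (parallel (ws @ vs))
    = replicate k (replicate (length ws) None) @ parallel ws"
proof -
  define m where "m = Max (length ` set (ws @ vs))"
  have "map (take (length ws)) (parallel (ws @ vs)) = parallel_to m ws"
    by (simp add: parallel_eq parallel_to_def m_def)
  moreover have "Max (length ` set ws) \<le> m" unfolding m_def using assms by (intro Max_mono) auto
  ultimately show ?thesis
    using parallel_to_pad[OF length_le_Max, where ws = ws and m = m] by (auto simp: parallel_eq)
qed

lemma parallel_append_drop:
  assumes "vs \<noteq> []"
  shows "\<exists>k. map (drop (length ws)) (parallel (ws @ vs))
    = replicate k (replicate (length vs) None) @ parallel vs"
proof -
  define m where "m = Max (length ` set (ws @ vs))"
  have "map (drop (length ws)) (parallel (ws @ vs)) = parallel_to m vs"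
    by (simp add: parallel_eq parallel_to_def m_def)
  moreover have "Max (length ` set vs) \<le> m" unfolding m_def using assms by (intro Max_mono) auto
  ultimately show ?thesis
    using parallel_to_pad[OF length_le_Max, where ws = vs and m = m] by (auto simp: parallel_eq)
qed

lemma unpad_padded_parallel:
  assumes "ws \<noteq> []"
  shows "unpad (length ws) (replicate k (replicate (length ws) None) @ parallel ws) = parallel ws"
  by (simp add: unpad_append unpad_replicate unpad_id[OF padding_notin_parallel[OF assms]])

section \<open>Multidimensional systems\<close>

lemma in_listset_iff_list_all2: "xs \<in> listset As \<longleftrightarrow> list_all2 (\<in>) xs As"
  by (induction As arbitrary: xs) (auto simp: set_Cons_def list_all2_Cons2)

text \<open>A joint letter is not padding throughout, but one of its two halves may be.\<close>

lemma multi_alphabet_append: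
  assumes "x \<in> multi_alphabet (Ss @ Ts)"
  shows "take (length Ss) x \<in> insert (replicate (length Ss) None) (multi_alphabet Ss)"
    and "drop (length Ss) x \<in> insert (replicate (length Ts) None) (multi_alphabet Ts)"
  using assms unfolding multi_alphabet_def in_listset_iff_list_all2
  by (auto simp: in_listset_iff_list_all2 list_all2_append2 dest: list_all2_lengthD)

text \<open>Each \<open>rep\<close> is onto its language, so preimages can be chosen track by
  track.\<close>

lemma multi_lang_eq:
  assumes "multi_system Ts"
  shows "multi_lang Ts = multi_rep Ts ` vectors (length Ts)"
proof -
  have "map2 rep Ts ` vectors (length Ts) = listset (map lang Ts)"
  proof (intro equalityI subsetI)
    fix ws assume "ws \<in> map2 rep Ts ` vectors (length Ts)"
    then show "ws \<in> listset (map lang Ts)"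
      using assms bij_betwE[OF bij_betw_rep] nth_mem
      by (fastforce simp: vectors_def multi_system_def in_listset_iff_list_all2 list_all2_conv_all_nth)
  next
    fix ws assume ws: "ws \<in> listset (map lang Ts)"
    then have len: "length ws = length Ts"
      and mem: "\<And>i. i < length Ts \<Longrightarrow> ws ! i \<in> lang (Ts ! i)"
      by (auto simp: in_listset_iff_list_all2 list_all2_conv_all_nth)
    have "\<exists>n. rep (Ts ! i) n = ws ! i" if "i < length Ts" for i
      using bij_betw_rep[of "Ts ! i"] mem[OF that] that assms
      by (auto simp: bij_betw_def multi_system_def image_iff set_eq_iff) (metis nth_mem)
    then obtain n where n: "\<And>i. i < length Ts \<Longrightarrow> rep (Ts ! i) (n i) = ws ! i" by metis
    have "ws = map2 rep Ts (map n [0..<length Ts])"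
      using len n by (auto intro!: nth_equalityI)
    then show "ws \<in> map2 rep Ts ` vectors (length Ts)"
      by (auto simp: vectors_def)
  qed
  then show ?thesis unfolding multi_lang_def multi_rep_def by (metis image_image)
qed

lemma multi_rep_inj:
  assumes "multi_system Ts"
  shows "inj_on (multi_rep Ts) (vectors (length Ts))"
proof (rule inj_onI)
  fix ns ms assume len: "ns \<in> vectors (length Ts)" "ms \<in> vectors (length Ts)"
    and eq: "multi_rep Ts ns = multi_rep Ts ms"
  have map2_eq: "map2 rep Ts ns = map2 rep Ts ms"
  proof (rule parallel_inj)
    show "length (map2 rep Ts ns) = length (map2 rep Ts ms)"
      using len by (simp add: vectors_def)
    show "parallel (map2 rep Ts ns) = parallel (map2 rep Ts ms)"
      using eq by (simp only: multi_rep_def)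
  qed
  show "ns = ms"
  proof (rule nth_equalityI)
    fix i assume "i < length ns"
    then have i: "i < length Ts" "i < length ns" "i < length ms"
      using len by (auto simp: vectors_def)
    have "inj (rep (Ts ! i))"
      using assms i bij_betw_rep[of "Ts ! i"] by (auto simp: multi_system_def bij_betw_def)
    moreover have "rep (Ts ! i) (ns ! i) = rep (Ts ! i) (ms ! i)"
      using arg_cong[OF map2_eq, of "\<lambda>ws. ws ! i"] i by simp
    ultimately show "ns ! i = ms ! i" by (simp add: inj_eq)
  qed (use len in \<open>simp add: vectors_def\<close>)
qed

text \<open>The first equation recovers \<open>ns\<close> from the joint word, the second gives the
  word at which the series of \<open>g\<close> is evaluated, and the third locates the padding
  prefix.\<close>

lemma multi_rep_append:
  assumes "multi_system Ss" "multi_system Ts" "length ns = length Ss" "length ms = length Ts"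
  shows "unpad (length Ss) (map (take (length Ss)) (multi_rep (Ss @ Ts) (ns @ ms))) = multi_rep Ss ns"
    and "unpad (length Ts) (map (drop (length Ss)) (multi_rep (Ss @ Ts) (ns @ ms))) = multi_rep Ts ms"
    and "\<exists>k. map (take (length Ss)) (multi_rep (Ss @ Ts) (ns @ ms))
       = replicate k (replicate (length Ss) None) @ multi_rep Ss ns"
proof -
  let ?ws = "map2 rep Ss ns" and ?vs = "map2 rep Ts ms"
  have ne: "?ws \<noteq> []" "?vs \<noteq> []" and len: "length ?ws = length Ss" "length ?vs = length Ts"
    using assms unfolding multi_system_def by (simp_all flip: length_greater_0_conv)
  have eq: "multi_rep (Ss @ Ts) (ns @ ms) = parallel (?ws @ ?vs)"
    using assms by (simp add: multi_rep_def)
  show "unpad (length Ss) (map (take (length Ss)) (multi_rep (Ss @ Ts) (ns @ ms))) = multi_rep Ss ns"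
    using parallel_append_take[OF ne(1), of ?vs] unpad_padded_parallel[OF ne(1)]
    unfolding eq len by (auto simp: multi_rep_def[of Ss])
  show "unpad (length Ts) (map (drop (length Ss)) (multi_rep (Ss @ Ts) (ns @ ms))) = multi_rep Ts ms"
    using parallel_append_drop[OF ne(2), of ?ws] unpad_padded_parallel[OF ne(2)]
    unfolding eq len by (auto simp: multi_rep_def[of Ts])
  show "\<exists>k. map (take (length Ss)) (multi_rep (Ss @ Ts) (ns @ ms))
       = replicate k (replicate (length Ss) None) @ multi_rep Ss ns"
    using parallel_append_take[OF ne(1), of ?vs] unfolding eq len by (simp add: multi_rep_def[of Ss])
qed

section \<open>Regularity of the composition through sums over lifts\<close>

theorem theorem9p8:
  fixes Ss Ss' :: "'a numeration list"
    and d d' :: nat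
    and f :: "nat list \<Rightarrow> nat list"
    and g :: "nat list \<Rightarrow> 'k :: {semiring_0, monoid_mult}"
  assumes "multi_system Ss" and "length Ss = d"
    and "multi_system Ss'" and "length Ss' = d'"
    and "f \<in> vectors d \<rightarrow> vectors d'"
    and "synchronized Ss Ss' f"
    and "regular_sequence Ss' g"
  shows "regular_sequence Ss (g \<circ> f)"
proof -
  define B where "B = multi_alphabet (Ss @ Ss')"
  define \<rho> where "\<rho> ns = multi_rep (Ss @ Ss') (ns @ f ns)" for ns
  define G where "G = \<rho> ` vectors d"
  define \<pi> :: "'a option list \<Rightarrow> 'a option list" where "\<pi> = take d"
  \<comment> \<open>\<open>h\<close> is a morphism sending a joint letter to a letter of the second
    system or to the empty word.\<close>
  define h :: "'a option list list \<Rightarrow> 'a option list list" where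
    "h z = unpad d' (map (drop d) z)" for z
  define R where "R w = (if w \<in> multi_lang Ss' then g (multi_val Ss' w) else 0)" for w
  have f: "length (f ns) = d'" if "ns \<in> vectors d" for ns
    using that assms(5) by (auto simp: vectors_def)
  have G: "regular_language B G"
  proof -
    have "multi_rep (Ss @ Ss') ` {ns @ f ns | ns. ns \<in> vectors (length Ss)} = G"
      by (auto simp: G_def \<rho>_def assms(2))
    then show ?thesis
      using assms(6) unfolding synchronized_def recognizable_set_def B_def by simp
  qed
  have GB: "G \<subseteq> lists B" and finB: "finite B" using G by (auto simp: regular_language_def)
  have \<rho>_fst: "unpad d (map \<pi> (\<rho> ns)) = multi_rep Ss ns"
    and \<rho>_snd: "h (\<rho> ns) = multi_rep Ss' (f ns)"
    and \<rho>_pad: "\<exists>k. map \<pi> (\<rho> ns) = replicate k (replicate d None) @ multi_rep Ss ns"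
    if "ns \<in> vectors d" for ns
    using multi_rep_append[OF assms(1,3), of ns "f ns"] f[OF that] that assms(2,4)
    by (auto simp: \<rho>_def \<pi>_def h_def vectors_def)
  have inj: "inj_on (multi_rep Ss) (vectors d)" "inj_on (multi_rep Ss') (vectors d')"
    using multi_rep_inj assms(1-4) by blast+
  \<comment> \<open>The first \<open>d\<close> tracks determine \<open>multi_rep Ss ns\<close>,
    hence \<open>ns\<close> by injectivity, and \<open>ns\<close> fixes the whole word because
    \<open>f\<close> is a function.\<close>
  have \<rho>_eqI: "u = v" if "u \<in> G" "v \<in> G" "unpad d (map \<pi> u) = unpad d (map \<pi> v)" for u v
    using that \<rho>_fst inj(1) unfolding G_def by (metis (no_types, lifting) imageE inj_onD)
  \<comment> \<open>Requiring a completion in \<open>G\<close> makes \<open>P\<close> finite; the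
    padding condition alone admits arbitrarily long words.\<close>
  define P where "P = {p \<in> lists B. (\<forall>x\<in>set p. \<pi> x = replicate d None) \<and> (\<exists>z. p @ z \<in> G)}"
  have unpad_P: "unpad d (map \<pi> (p @ z)) = unpad d (map \<pi> z)" if "p \<in> P" for p z
    using that by (auto simp: P_def unpad_append intro!: unpad_padding)
  text \<open>A state of the automaton from which a final state can be reached determines the padding
    prefix leading to it: two such prefixes, completed in the same way, represent
    \<open>(n, f n)\<close> for the same \<open>n\<close>.\<close>
  have finP: "finite P"
  proof -
    obtain Q :: "nat set" and \<delta> q0 F where Q: "finite Q" "q0 \<in> Q"
      and \<delta>: "\<And>q a. q \<in> Q \<Longrightarrow> a \<in> B \<Longrightarrow> \<delta> q a \<in> Q"
      and G_eq: "G = {w \<in> lists B. foldl \<delta> q0 w \<in> F}"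
      using G unfolding regular_language_def by blast
    have "inj_on (foldl \<delta> q0) P"
    proof (rule inj_onI)
      fix p p' assume pp: "p \<in> P" "p' \<in> P" and eq: "foldl \<delta> q0 p = foldl \<delta> q0 p'"
      obtain z where z: "p @ z \<in> G" using pp by (auto simp: P_def)
      then have z': "p' @ z \<in> G" using eq pp by (auto simp: G_eq P_def)
      have "p @ z = p' @ z" using z z' by (rule \<rho>_eqI) (simp only: unpad_P pp)
      then show "p = p'" by simp
    qed
    moreover have "foldl \<delta> q0 ` P \<subseteq> Q" using foldl_in_states[of Q B \<delta>] \<delta> Q by (auto simp: P_def)
    ultimately show ?thesis using Q(1) inj_on_finite by blast
  qed
  have "recognizable_series (multi_alphabet Ss)
    (\<lambda>w. \<Sum>p\<in>P. \<Sum>z\<in>lifts \<pi> B w. if p @ z \<in> G then R (h (p @ z)) else 0)"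
  proof (rule recognizable_series_sum_lifts[OF G _ _ _ finP])
    show "recognizable_series (multi_alphabet Ss') R"
      using assms(7) by (simp add: regular_sequence_def R_def[abs_def])
    show "h (u @ v) = h u @ h v" for u v by (simp add: h_def unpad_append)
    show "h z \<in> lists (multi_alphabet Ss')" if "z \<in> lists B" for z
      using that multi_alphabet_append(2)[of _ Ss Ss'] assms(2,4)
      by (fastforce simp: h_def unpad_def B_def)
  qed (auto simp: P_def)
  moreover have "(if w \<in> multi_lang Ss then (g \<circ> f) (multi_val Ss w) else 0)
      = (\<Sum>p\<in>P. \<Sum>z\<in>lifts \<pi> B w. if p @ z \<in> G then R (h (p @ z)) else 0)"
    if w: "w \<in> lists (multi_alphabet Ss)" for w
  proof -
    \<comment> \<open>No letter of \<open>w\<close> is padding throughout, so \<open>w\<close> can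
      be recovered from any of its lifts, even behind a prefix in \<open>P\<close>.\<close>
    have "unpad d w = w"
      using w assms(2) by (intro unpad_id) (auto simp: multi_alphabet_def)
    then have unpad_w: "unpad d (map \<pi> (p @ z)) = w" if "p \<in> P" "z \<in> lifts \<pi> B w" for p z
      using that by (simp add: unpad_P lifts_def del: map_append)
    show ?thesis
    proof (cases "w \<in> multi_lang Ss")
      case False
      \<comment> \<open>A nonzero term would exhibit \<open>w\<close> as the representation of some
        vector.\<close>
      have "p @ z \<notin> G" if "p \<in> P" "z \<in> lifts \<pi> B w" for p z
      proof
        assume "p @ z \<in> G"
        then obtain ns where ns: "p @ z = \<rho> ns" "ns \<in> vectors d" by (auto simp: G_def)
        then have "w = multi_rep Ss ns" using unpad_w[OF that] \<rho>_fst by metis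
        then show False using False ns(2) multi_lang_eq[OF assms(1)] assms(2) by blast
      qed
      then show ?thesis using False by simp
    next
      case True
      then obtain ns where ns: "ns \<in> vectors d" "w = multi_rep Ss ns"
        using multi_lang_eq[OF assms(1)] assms(2) by auto
      obtain k where k: "map \<pi> (\<rho> ns) = replicate k (replicate d None) @ w"
        using \<rho>_pad[OF ns(1)] ns(2) by auto
      \<comment> \<open>The cut is made where the padding of the first \<open>d\<close> tracks ends;
        \<open>p0\<close> is empty if the last tracks are no longer than \<open>w\<close>.\<close>
      define p0 where "p0 = take k (\<rho> ns)"
      define z0 where "z0 = drop k (\<rho> ns)"
      have \<rho>_split: "p0 @ z0 = \<rho> ns" by (simp add: p0_def z0_def)
      have \<rho>: "\<rho> ns \<in> G" "\<rho> ns \<in> lists B" using ns GB by (auto simp: G_def)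
      have z0: "z0 \<in> lifts \<pi> B w"
        using k \<rho>(2) by (auto simp: z0_def lifts_def simp flip: drop_map dest: in_set_dropD)
      have "map \<pi> p0 = replicate k (replicate d None)"
        using k by (simp add: p0_def flip: take_map)
      then have "\<pi> x = replicate d None" if "x \<in> set p0" for x
        using that by (metis image_eqI in_set_replicate set_map)
      moreover have "p0 @ z0 \<in> G" using \<rho> \<rho>_split by simp
      ultimately have p0: "p0 \<in> P"
        using \<rho>(2) by (auto simp: P_def p0_def dest: in_set_takeD)
      \<comment> \<open>Membership in \<open>G\<close> fixes the concatenation, and a lift has the
        length of \<open>w\<close>, which fixes the cut.\<close>
      have unique: "p = p0 \<and> z = z0" if "p \<in> P" "z \<in> lifts \<pi> B w" "p @ z \<in> G" for p z
      proof -
        have "p @ z = p0 @ z0"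
          using that(3) \<open>p0 @ z0 \<in> G\<close>
          by (rule \<rho>_eqI) (simp only: unpad_w[OF that(1,2)] unpad_w[OF p0 z0])
        moreover have "length z = length z0"
          using that(2) z0 by (metis (mono_tags, lifting) length_map lifts_def mem_Collect_eq)
        ultimately show ?thesis by simp
      qed
      have "(\<Sum>p\<in>P. \<Sum>z\<in>lifts \<pi> B w. if p @ z \<in> G then R (h (p @ z)) else 0)
          = (\<Sum>p\<in>P. \<Sum>z\<in>lifts \<pi> B w. if p = p0 \<and> z = z0 then R (h (\<rho> ns)) else 0)"
      proof (intro sum.cong refl)
        fix p z assume pz: "p \<in> P" "z \<in> lifts \<pi> B w"
        show "(if p @ z \<in> G then R (h (p @ z)) else 0)
            = (if p = p0 \<and> z = z0 then R (h (\<rho> ns)) else 0)"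
          using unique[OF pz] \<open>p0 @ z0 \<in> G\<close> \<rho>_split by metis
      qed
      also have "\<dots> = (\<Sum>p\<in>P. if p = p0 then R (h (\<rho> ns)) else 0)"
      proof (intro sum.cong refl)
        fix p
        show "(\<Sum>z\<in>lifts \<pi> B w. if p = p0 \<and> z = z0 then R (h (\<rho> ns)) else 0)
            = (if p = p0 then R (h (\<rho> ns)) else 0)"
          using z0 finite_lifts[OF finB, of \<pi> w] by (cases "p = p0") simp_all
      qed
      also have "\<dots> = R (h (\<rho> ns))" using p0 finP by simp
      \<comment> \<open>\<open>h\<close> yields the representation of \<open>f ns\<close>, which
        lies in the numeration language, so the default value 0 of \<open>R\<close> is
        avoided.\<close>
      also have "\<dots> = g (f ns)"
      proof -
        have fns: "f ns \<in> vectors d'" using f ns by (simp add: vectors_def)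
        then have "multi_val Ss' (multi_rep Ss' (f ns)) = f ns"
          using inj(2) assms(4) by (simp add: multi_val_def)
        moreover have "multi_rep Ss' (f ns) \<in> multi_lang Ss'"
          using fns multi_lang_eq[OF assms(3)] assms(4) by simp
        ultimately show ?thesis using \<rho>_snd[OF ns(1)] by (simp add: R_def)
      qed
      finally show ?thesis
        using True ns inj(1) assms(2) by (simp add: multi_val_def)
    qed
  qed
  \<comment> \<open>The two series agree on words over the alphabet, and recognizability inspects no
    others.\<close>
  ultimately show ?thesis
    unfolding regular_sequence_def recognizable_series_def by (metis (no_types, lifting))
qed

end
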